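(* Consider the following process on the cycle with $n\ge 3$ nodes $1,\dots,n$ (node $i$ adjacent to $i-1$ and $i+1$, indices modulo $n$). Each node $i$ carries a real load $x_i(t)$, and initially all loads are equal. At each step $t=0,1,2,\dots$, an edge $\{i,i+1\}$ is chosen uniformly at random among the $n$ cycle edges and a weight $w(t)$ is drawn from a fixed real distribution $W$ with finite second moment, independently of everything else; then $x_i(t+1)=x_{i+1}(t+1)=\frac{x_i(t)+x_{i+1}(t)+w(t)}{2}$, and all other loads are unchanged. Let $Gap(t)=\max_i x_i(t)-\min_i x_i(t)$. Then \[\lim_{t\to\infty}\mathbb{E}[Gap(t)^2]=\Omega\big(n\,\mathbb{E}[W^2]\big),\] i.e. the expected squared gap is, in the limit $t\to\infty$, bounded below by $c\,n\,\mathbb{E}[W^2]$ for an absolute constant $c>0$.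
   Context: The edge choice and the weight are independent across steps and independent of the current loads. *)

theory Defs
  imports "HOL-Probability.Probability"
begin

text \<open>
  The nodes of the cycle are \<open>0, \<dots>, n - 1\<close> (node \<open>n\<close> is called \<open>0\<close>), and edge \<open>i < n\<close> joins the
  nodes \<open>i\<close> and \<open>i + 1\<close> modulo \<open>n\<close>. Values of a load vector outside \<open>{..<n}\<close> are irrelevant.
\<close>

definition average_step :: "nat \<Rightarrow> nat \<times> real \<Rightarrow> (nat \<Rightarrow> real) \<Rightarrow> nat \<Rightarrow> real" where
  "average_step n s x =
     (let i = fst s; j = Suc i mod n; a = (x i + x j + snd s) / 2 in x(i := a, j := a))"

text \<open>
  A sample point \<open>\<omega>\<close> lists, for each time \<open>t\<close>, the pair \<open>\<omega> t\<close> of the chosen edge and the weight.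
\<close>

primrec loads :: "nat \<Rightarrow> real \<Rightarrow> (nat \<Rightarrow> nat \<times> real) \<Rightarrow> nat \<Rightarrow> nat \<Rightarrow> real" where
  "loads n x0 \<omega> 0 = (\<lambda>i. x0)"
| "loads n x0 \<omega> (Suc t) = average_step n (\<omega> t) (loads n x0 \<omega> t)"

definition gap :: "nat \<Rightarrow> (nat \<Rightarrow> real) \<Rightarrow> real" where
  "gap n x = Max (x ` {..<n}) - Min (x ` {..<n})"

text \<open>
  The canonical space of the process: being a product measure, it makes all edge choices and all
  weights mutually independent, the edges uniform and the weights distributed as \<open>W\<close>.
\<close>

definition process_space :: "nat \<Rightarrow> real measure \<Rightarrow> (nat \<Rightarrow> nat \<times> real) measure" where
  "process_space n W = (\<Pi>\<^sub>M t\<in>UNIV. measure_pmf (pmf_of_set {..<n}) \<Otimes>\<^sub>M W)"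

end

theory Submission
  imports Defs
begin

text \<open>
  Let \<open>S k\<close> be the sum over all nodes \<open>j\<close> of the squared load difference of \<open>j\<close> and \<open>j + k\<close>, and
  \<open>T\<close> the sum of the squared load differences over all ordered pairs of nodes. With \<open>s k\<close> the
  expectation of \<open>S k\<close> and \<open>v = E W\<^sup>2\<close>, one step increases \<open>E T\<close> by \<open>(n - 2) v - s 1\<close> and
  \<open>n s k\<close> by \<open>s (k - 1) - 2 s k + s (k + 1) + (n v - s 1)\<close> for \<open>2 \<le> k \<le> n - 2\<close>; for \<open>k = 1\<close> the
  last term is halved.

  The expectation of a convex functional that ignores additive constants is nondecreasing in time:
  by linearity of the step, averaging the very first step over its edge has the effect of starting
  from a shifted constant vector one step later. This applies to \<open>T\<close> and to the squared gap.
  Monotonicity of \<open>E T\<close> gives \<open>s 1 \<le> (n - 2) v\<close>; since \<open>S 1\<close> controls the squared gap, which in turn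
  controls \<open>T\<close>, both expectations converge. Hence the increments of \<open>E T\<close> vanish in the limit, that
  is \<open>s 1 \<longlonglongrightarrow> (n - 2) v\<close>, and the recurrence yields \<open>s k \<longlonglongrightarrow> v (k (n - k) - 1)\<close> inductively.
  Finally \<open>n\<close> times the squared gap dominates \<open>S (n div 2)\<close>.
\<close>

section \<open>Cyclic sums\<close>

lemma sum_mod_shift:
  fixes f :: "nat \<Rightarrow> 'a::comm_monoid_add"
  assumes "n > 0"
  shows "(\<Sum>j<n. f ((j + m) mod n)) = (\<Sum>j<n. f j)"
proof (induction m)
  case 0
  then show ?case by (intro sum.cong) auto
next
  case (Suc m)
  obtain l where n_eq: "n = Suc l" using assms by (cases n) auto
  have "(\<Sum>j<n. f ((j + Suc m) mod n)) = (\<Sum>j<l. f ((Suc j + m) mod n)) + f ((n + m) mod n)"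
    by (simp add: n_eq)
  also have "\<dots> = (\<Sum>j<n. f ((j + m) mod n))"
    using mod_add_self1[of n m] unfolding n_eq sum.lessThan_Suc_shift by (simp add: add.commute)
  finally show ?case using Suc by simp
qed

lemma add_mod_eq_iff:
  fixes a b j n :: nat
  assumes "a < n" "b < n"
  shows "(j + a) mod n = (j + b) mod n \<longleftrightarrow> a = b"
  using assms mod_eq_dvd_iff_nat[of "j + a" "j + b" n] mod_eq_dvd_iff_nat[of "j + b" "j + a" n]
  by (cases a b rule: linorder_cases) (auto dest!: dvd_imp_le)

lemma Suc_mod_neq:
  fixes i n :: nat
  assumes "i < n" "n \<ge> 2"
  shows "Suc i mod n \<noteq> i"
  using assms add_mod_eq_iff[of 1 n 0 i] by simp

lemma sum_mod_Suc:
  fixes f :: "nat \<Rightarrow> 'a::comm_monoid_add"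
  assumes "n > 0"
  shows "(\<Sum>j<n. f (Suc j mod n)) = (\<Sum>j<n. f j)"
  using sum_mod_shift[OF assms, of f 1] by simp

definition cyclic_corr ::
  "nat \<Rightarrow> nat \<Rightarrow> (nat \<Rightarrow> 'a::comm_semiring_0) \<Rightarrow> (nat \<Rightarrow> 'a) \<Rightarrow> 'a" where
  "cyclic_corr n k x y = (\<Sum>j<n. x j * y ((j + k) mod n))"

lemma cyclic_corr_add:
  "cyclic_corr n k (\<lambda>j. x j + y j) z = cyclic_corr n k x z + cyclic_corr n k y z"
  "cyclic_corr n k z (\<lambda>j. x j + y j) = cyclic_corr n k z x + cyclic_corr n k z y"
  by (simp_all add: cyclic_corr_def sum.distrib algebra_simps)

lemma cyclic_corr_reflect:
  assumes "n > 0" "n dvd k + m"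
  shows "cyclic_corr n k x y = cyclic_corr n m y x"
proof -
  have "((j + m) mod n + k) mod n = j" if "j < n" for j
  proof -
    have "((j + m) mod n + k) mod n = (j + (k + m)) mod n"
      by (simp add: mod_simps ac_simps)
    also have "\<dots> = j"
      using assms(2) that by (auto elim!: dvdE)
    finally show ?thesis .
  qed
  then have "(\<Sum>j<n. (\<lambda>j. x j * y ((j + k) mod n)) ((j + m) mod n)) = cyclic_corr n m y x"
    by (simp add: cyclic_corr_def mult.commute)
  then show ?thesis
    using sum_mod_shift[OF assms(1), of "\<lambda>j. x j * y ((j + k) mod n)" m]
    by (simp add: cyclic_corr_def)
qed

section \<open>Quadratic functionals under one step\<close>

definition increment :: "nat \<Rightarrow> nat \<Rightarrow> real \<Rightarrow> (nat \<Rightarrow> real) \<Rightarrow> nat \<Rightarrow> real" where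
  "increment n i w x j = average_step n (i, w) x j - x j"

lemma average_step_increment: "average_step n (i, w) x = (\<lambda>j. x j + increment n i w x j)"
  by (simp add: increment_def)

lemma average_step_apply:
  "average_step n (i, w) x j =
     (if j = i \<or> j = Suc i mod n then (x i + x (Suc i mod n) + w) / 2 else x j)"
  by (auto simp: average_step_def Let_def)

lemma increment_apply:
  "increment n i w x j =
     (if j = i then (x (Suc i mod n) - x i + w) / 2
      else if j = Suc i mod n then (x i - x (Suc i mod n) + w) / 2 else 0)"
  by (auto simp: increment_def average_step_apply field_simps)

lemma sum_increment_mult:
  assumes "i < n" "n \<ge> 2"
  shows "(\<Sum>j<n. increment n i w x j * g j) =
    (x (Suc i mod n) - x i + w) / 2 * g i + (x i - x (Suc i mod n) + w) / 2 * g (Suc i mod n)"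
proof -
  have "(\<Sum>j<n. increment n i w x j * g j) = (\<Sum>j\<in>{i, Suc i mod n}. increment n i w x j * g j)"
    using assms by (intro sum.mono_neutral_right) (auto simp: increment_apply)
  then show ?thesis
    using Suc_mod_neq[OF assms] by (simp add: increment_apply)
qed

lemma sum_average_step:
  assumes "i < n" "n \<ge> 2"
  shows "(\<Sum>j<n. average_step n (i, w) x j) = (\<Sum>j<n. x j) + w"
  using sum_increment_mult[OF assms, of w x "\<lambda>_. 1"]
  by (simp add: average_step_increment sum.distrib field_simps)

lemma sum_squares_average_step:
  assumes "i < n" "n \<ge> 2"
  shows "(\<Sum>j<n. (average_step n (i, w) x j)\<^sup>2) =
    (\<Sum>j<n. (x j)\<^sup>2) - (x i - x (Suc i mod n))\<^sup>2 / 2 + w * (x i + x (Suc i mod n)) + w\<^sup>2 / 2"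
proof -
  have "(\<Sum>j<n. (average_step n (i, w) x j)\<^sup>2) =
      (\<Sum>j<n. (x j)\<^sup>2) + (\<Sum>j<n. increment n i w x j * (2 * x j + increment n i w x j))"
    by (simp add: average_step_increment power2_eq_square sum.distrib algebra_simps sum_distrib_left)
  then show ?thesis
    unfolding sum_increment_mult[OF assms] using Suc_mod_neq[OF assms]
    by (simp add: increment_apply power2_eq_square field_simps)
qed

definition shift_dist :: "nat \<Rightarrow> nat \<Rightarrow> (nat \<Rightarrow> real) \<Rightarrow> real" where
  "shift_dist n k x = (\<Sum>j<n. (x j - x ((j + k) mod n))\<^sup>2)"

lemma shift_dist_0 [simp]: "shift_dist n 0 x = 0"
  by (simp add: shift_dist_def)

lemma shift_dist_eq_cyclic_corr:
  assumes "n > 0"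
  shows "shift_dist n k x = 2 * ((\<Sum>j<n. (x j)\<^sup>2) - cyclic_corr n k x x)"
proof -
  have "shift_dist n k x = (\<Sum>j<n. (x j)\<^sup>2) + (\<Sum>j<n. (x ((j + k) mod n))\<^sup>2) - 2 * cyclic_corr n k x x"
    by (simp add: shift_dist_def cyclic_corr_def power2_diff sum.distrib sum_subtractf
        sum_distrib_left mult.assoc)
  then show ?thesis
    using sum_mod_shift[OF assms, of "\<lambda>j. (x j)\<^sup>2" k] by simp
qed

lemma sum_edges_sum_squares_average_step:
  assumes "n \<ge> 2"
  shows "(\<Sum>i<n. \<Sum>j<n. (average_step n (i, w) x j)\<^sup>2) =
    real n * (\<Sum>j<n. (x j)\<^sup>2) - shift_dist n 1 x / 2 + 2 * w * (\<Sum>j<n. x j) + real n * w\<^sup>2 / 2"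
proof -
  have "(\<Sum>i<n. \<Sum>j<n. (average_step n (i, w) x j)\<^sup>2) =
      (\<Sum>i<n. (\<Sum>j<n. (x j)\<^sup>2) - (x i - x (Suc i mod n))\<^sup>2 / 2 + w * (x i + x (Suc i mod n)) + w\<^sup>2 / 2)"
    using assms by (intro sum.cong refl sum_squares_average_step) auto
  also have "\<dots> = real n * (\<Sum>j<n. (x j)\<^sup>2) - shift_dist n 1 x / 2
      + w * ((\<Sum>i<n. x i) + (\<Sum>i<n. x (Suc i mod n))) + real n * w\<^sup>2 / 2"
    by (simp add: shift_dist_def sum.distrib sum_subtractf sum_distrib_left sum_divide_distrib
        distrib_left)
  finally show ?thesis
    using assms sum_mod_Suc[of n x] by simp
qed

lemma sum_edges_cyclic_corr_increment:
  assumes "n \<ge> 2" "k \<ge> 1"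
  shows "(\<Sum>i<n. cyclic_corr n k (increment n i w x) x) =
    (cyclic_corr n (k - 1) x x + cyclic_corr n (k + 1) x x) / 2 - cyclic_corr n k x x
    + w * (\<Sum>j<n. x j)"
proof -
  have n_pos: "n > 0" using assms by simp
  let ?s = "\<lambda>i. Suc i mod n"
  have "cyclic_corr n k (increment n i w x) x =
      (x (?s i) * x ((i + k) mod n) - x i * x ((i + k) mod n)
        + x i * x ((?s i + k) mod n) - x (?s i) * x ((?s i + k) mod n)
        + w * (x ((i + k) mod n) + x ((?s i + k) mod n))) / 2" if "i < n" for i
    unfolding cyclic_corr_def sum_increment_mult[OF that assms(1)] by (simp add: field_simps)
  then have "(\<Sum>i<n. cyclic_corr n k (increment n i w x) x) =
      ((\<Sum>i<n. x (?s i) * x ((i + k) mod n)) - (\<Sum>i<n. x i * x ((i + k) mod n))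
        + (\<Sum>i<n. x i * x ((?s i + k) mod n)) - (\<Sum>i<n. x (?s i) * x ((?s i + k) mod n))
        + w * ((\<Sum>i<n. x ((i + k) mod n)) + (\<Sum>i<n. x ((?s i + k) mod n)))) / 2"
    unfolding sum_distrib_left sum_divide_distrib sum.distrib[symmetric] sum_subtractf[symmetric]
    by (intro sum.cong) auto
  also have "(\<Sum>i<n. x (?s i) * x ((?s i + k) mod n)) = cyclic_corr n k x x"
    unfolding cyclic_corr_def by (rule sum_mod_Suc[OF n_pos])
  also have "(\<Sum>i<n. x (?s i) * x ((i + k) mod n)) = (\<Sum>i<n. x (?s i) * x ((?s i + (k - 1)) mod n))"
    using assms(2) by (simp only: mod_add_left_eq) simp
  also have "\<dots> = cyclic_corr n (k - 1) x x"
    unfolding cyclic_corr_def by (rule sum_mod_Suc[OF n_pos])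
  also have "(\<Sum>i<n. x i * x ((?s i + k) mod n)) = cyclic_corr n (k + 1) x x"
    by (simp add: cyclic_corr_def mod_simps)
  also have "(\<Sum>i<n. x ((i + k) mod n)) = (\<Sum>j<n. x j)"
    by (rule sum_mod_shift[OF n_pos])
  also have "(\<Sum>i<n. x ((?s i + k) mod n)) = (\<Sum>j<n. x j)"
    using sum_mod_shift[OF n_pos, of x "Suc k"] by (simp add: mod_simps)
  finally show ?thesis
    by (simp add: cyclic_corr_def field_simps)
qed

lemma sum_edges_cyclic_corr_average_step:
  assumes "n \<ge> 2" "k \<ge> 1"
  shows "(\<Sum>i<n. cyclic_corr n k (average_step n (i, w) x) (average_step n (i, w) x)) =
    (real n - 2) * cyclic_corr n k x x + cyclic_corr n (k - 1) x x + cyclic_corr n (k + 1) x x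
    + 2 * w * (\<Sum>j<n. x j) + (\<Sum>i<n. cyclic_corr n k (increment n i w x) (increment n i w x))"
proof -
  have n_pos: "n > 0" using assms by simp
  define m where "m = (n - 1) * k" \<comment> \<open>a natural number representing \<open>- k\<close> modulo \<open>n\<close>\<close>
  have m_plus_k: "m + k = n * k"
    unfolding m_def using n_pos by (cases n) auto
  have m_ge_1: "m \<ge> 1"
    using assms by (simp add: m_def)
  have dvd: "n dvd k + m" "n dvd m + k" "n dvd (m - 1) + (k + 1)" "n dvd (m + 1) + (k - 1)"
    using m_plus_k m_ge_1 assms(2) by (metis dvd_triv_left add.commute add.left_commute le_add_diff_inverse)+
  have "(\<Sum>i<n. cyclic_corr n k x (increment n i w x)) = (\<Sum>i<n. cyclic_corr n m (increment n i w x) x)"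
    by (intro sum.cong refl cyclic_corr_reflect n_pos dvd)
  also have "\<dots> = (cyclic_corr n (m - 1) x x + cyclic_corr n (m + 1) x x) / 2 - cyclic_corr n m x x
      + w * (\<Sum>j<n. x j)"
    by (rule sum_edges_cyclic_corr_increment[OF assms(1) m_ge_1])
  also have "cyclic_corr n m x x = cyclic_corr n k x x"
    by (rule cyclic_corr_reflect[OF n_pos dvd(2)])
  also have "cyclic_corr n (m - 1) x x = cyclic_corr n (k + 1) x x"
    by (rule cyclic_corr_reflect[OF n_pos dvd(3)])
  also have "cyclic_corr n (m + 1) x x = cyclic_corr n (k - 1) x x"
    by (rule cyclic_corr_reflect[OF n_pos dvd(4)])
  finally show ?thesis
    unfolding average_step_increment cyclic_corr_add sum.distrib
    by (simp add: sum_edges_cyclic_corr_increment[OF assms] field_simps)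
qed

lemma cyclic_corr_increment_increment:
  assumes "i < n" "1 \<le> k" "k + 2 \<le> n"
  shows "cyclic_corr n k (increment n i w x) (increment n i w x) =
    (if k = 1 then (w\<^sup>2 - (x i - x (Suc i mod n))\<^sup>2) / 4 else 0)"
proof -
  have positions: "(i + k) mod n \<noteq> i" "(i + k) mod n = Suc i mod n \<longleftrightarrow> k = 1"
    "(Suc i mod n + k) mod n \<noteq> i" "(Suc i mod n + k) mod n \<noteq> Suc i mod n"
    using assms add_mod_eq_iff[of k n 0 i] add_mod_eq_iff[of k n 1 i]
      add_mod_eq_iff[of "k + 1" n 0 i] add_mod_eq_iff[of "k + 1" n 1 i]
    by (auto simp: mod_simps)
  have "cyclic_corr n k (increment n i w x) (increment n i w x) =
      (x (Suc i mod n) - x i + w) / 2 * increment n i w x ((i + k) mod n)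
      + (x i - x (Suc i mod n) + w) / 2 * increment n i w x ((Suc i mod n + k) mod n)"
    unfolding cyclic_corr_def using assms by (intro sum_increment_mult) auto
  then show ?thesis
    using positions Suc_mod_neq[of i n] assms by (auto simp: increment_apply power2_eq_square field_simps)
qed

lemma sum_edges_shift_dist_average_step:
  assumes "1 \<le> k" "k + 2 \<le> n"
  shows "(\<Sum>i<n. shift_dist n k (average_step n (i, w) x)) =
    (real n - 2) * shift_dist n k x + shift_dist n (k - 1) x + shift_dist n (k + 1) x
    + (if k = 1 then 1 / 2 else 1) * (real n * w\<^sup>2 - shift_dist n 1 x)"
proof -
  have n_bounds: "n > 0" "n \<ge> 2" using assms by auto
  have "(\<Sum>i<n. cyclic_corr n k (increment n i w x) (increment n i w x)) =
      (\<Sum>i<n. if k = 1 then (w\<^sup>2 - (x i - x (Suc i mod n))\<^sup>2) / 4 else 0)"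
    using assms by (intro sum.cong refl cyclic_corr_increment_increment) auto
  also have "\<dots> = (if k = 1 then (real n * w\<^sup>2 - shift_dist n 1 x) / 4 else 0)"
    by (simp add: shift_dist_def sum_subtractf sum_divide_distrib[symmetric])
  finally show ?thesis
    unfolding shift_dist_eq_cyclic_corr[OF n_bounds(1)] sum_distrib_left[symmetric] sum_subtractf
      sum_edges_sum_squares_average_step[OF n_bounds(2)]
      sum_edges_cyclic_corr_average_step[OF n_bounds(2) assms(1)]
    by (simp add: field_simps)
qed

definition total_dist :: "nat \<Rightarrow> (nat \<Rightarrow> real) \<Rightarrow> real" where
  "total_dist n x = (\<Sum>a<n. \<Sum>b<n. (x a - x b)\<^sup>2)"

lemma total_dist_eq_sums: "total_dist n x = 2 * (real n * (\<Sum>j<n. (x j)\<^sup>2) - (\<Sum>j<n. x j)\<^sup>2)"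
  by (simp add: total_dist_def power2_eq_square sum_product algebra_simps sum.distrib sum_subtractf
      sum_distrib_left)

lemma sum_edges_total_dist_average_step:
  assumes "n \<ge> 2"
  shows "(\<Sum>i<n. total_dist n (average_step n (i, w) x)) =
    real n * (total_dist n x - shift_dist n 1 x + (real n - 2) * w\<^sup>2)"
proof -
  have "(\<Sum>i<n. (\<Sum>j<n. average_step n (i, w) x j)\<^sup>2) = real n * ((\<Sum>j<n. x j) + w)\<^sup>2"
    using assms by (simp add: sum_average_step)
  then show ?thesis
    unfolding total_dist_eq_sums sum_distrib_left[symmetric] sum_subtractf
      sum_edges_sum_squares_average_step[OF assms]
    by (simp add: power2_eq_square algebra_simps)
qed

section \<open>Comparison with the gap\<close>

lemma gap_attained:
  assumes "n > 0"
  obtains a b where "a < n" "b < n" "gap n x = x a - x b"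
proof -
  have "x ` {..<n} \<noteq> {}" "finite (x ` {..<n})" using assms by (auto simp: lessThan_empty_iff)
  then have "Max (x ` {..<n}) \<in> x ` {..<n}" "Min (x ` {..<n}) \<in> x ` {..<n}"
    by (auto intro: Max_in Min_in simp del: Max_in Min_in)
  then show thesis using that unfolding gap_def by auto
qed

lemma square_diff_le_square_gap:
  assumes "a < n" "b < n"
  shows "(x a - x b)\<^sup>2 \<le> (gap n x)\<^sup>2"
proof (rule abs_le_square_iff[THEN iffD1])
  have "x a \<le> Max (x ` {..<n})" "x b \<le> Max (x ` {..<n})"
    "Min (x ` {..<n}) \<le> x a" "Min (x ` {..<n}) \<le> x b"
    using assms by (auto intro!: Max_ge Min_le)
  then show "\<bar>x a - x b\<bar> \<le> \<bar>gap n x\<bar>" unfolding gap_def by linarith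
qed

lemma shift_dist_nonneg: "0 \<le> shift_dist n k x"
  by (simp add: shift_dist_def sum_nonneg)

lemma total_dist_nonneg: "0 \<le> total_dist n x"
  by (simp add: total_dist_def sum_nonneg)

lemma shift_dist_le_square_gap: "shift_dist n k x \<le> real n * (gap n x)\<^sup>2"
  using sum_bounded_above[of "{..<n}" "\<lambda>j. (x j - x ((j + k) mod n))\<^sup>2" "(gap n x)\<^sup>2"]
  by (simp add: shift_dist_def square_diff_le_square_gap)

lemma total_dist_le_square_gap: "total_dist n x \<le> (real n)\<^sup>2 * (gap n x)\<^sup>2"
proof -
  have "total_dist n x \<le> (\<Sum>a<n. \<Sum>b<n. (gap n x)\<^sup>2)"
    unfolding total_dist_def by (intro sum_mono square_diff_le_square_gap) auto
  then show ?thesis by (simp add: power2_eq_square)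
qed

lemma square_diff_le_shift_dist:
  assumes "a < n" "b < n"
  shows "(x a - x b)\<^sup>2 \<le> real n * shift_dist n 1 x"
  using assms
proof (induction a b rule: linorder_wlog)
  case (le a b)
  have "(x b - x a)\<^sup>2 = (\<Sum>j=a..<b. x (Suc j) - x j)\<^sup>2"
    using le by (simp add: sum_Suc_diff')
  also have "\<dots> \<le> (\<Sum>j=a..<b. (x (Suc j) - x j)\<^sup>2) * real (b - a)"
    using sum_squared_le_sum_of_squares[of "\<lambda>j. x (Suc j) - x j" "{a..<b}"] by simp
  also have "(\<Sum>j=a..<b. (x (Suc j) - x j)\<^sup>2) = (\<Sum>j=a..<b. (x j - x ((j + 1) mod n))\<^sup>2)"
    using le by (intro sum.cong) (auto simp: power2_commute)
  also have "\<dots> * real (b - a) \<le> shift_dist n 1 x * real n"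
    unfolding shift_dist_def using le
    by (intro mult_mono sum_mono2) (auto intro: sum_nonneg)
  finally show ?case by (simp add: power2_commute mult.commute)
next
  case (sym a b)
  then show ?case by (simp add: power2_commute)
qed

lemma square_gap_le_shift_dist: "n > 0 \<Longrightarrow> (gap n x)\<^sup>2 \<le> real n * shift_dist n 1 x"
  by (metis gap_attained square_diff_le_shift_dist)

section \<open>Translation-invariant convex functionals\<close>

text \<open>Convexity (take \<open>d = 0\<close>) together with invariance under adding constants (take \<open>m = 1\<close>).\<close>

definition translation_convex :: "nat \<Rightarrow> ((nat \<Rightarrow> real) \<Rightarrow> real) \<Rightarrow> bool" where
  "translation_convex n F \<longleftrightarrow>
     (\<forall>m x y d. (\<forall>j<n. (\<Sum>i<m. y i j) = real m * (x j + d)) \<longrightarrow>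
        real m * F x \<le> (\<Sum>i<m. F (y i)))"

lemma translation_convexI:
  assumes "\<And>m x y d. (\<And>j. j < n \<Longrightarrow> (\<Sum>i<m. y i j) = real m * (x j + d)) \<Longrightarrow>
    real m * F x \<le> (\<Sum>i<m. F (y i))"
  shows "translation_convex n F"
  using assms unfolding translation_convex_def by blast

lemma translation_convexD:
  assumes "translation_convex n F" "\<And>j. j < n \<Longrightarrow> (\<Sum>i<m. y i j) = real m * (x j + d)"
  shows "real m * F x \<le> (\<Sum>i<m. F (y i))"
  using assms unfolding translation_convex_def by blast

lemma translation_convex_square_diff:
  assumes "a < n" "b < n"
  shows "translation_convex n (\<lambda>x. (x a - x b)\<^sup>2)"
proof (rule translation_convexI)
  fix m :: nat and x :: "nat \<Rightarrow> real" and y :: "nat \<Rightarrow> nat \<Rightarrow> real" and d :: real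
  assume "\<And>j. j < n \<Longrightarrow> (\<Sum>i<m. y i j) = real m * (x j + d)"
  then have "(\<Sum>i<m. y i a - y i b) = real m * (x a - x b)"
    using assms by (simp add: sum_subtractf algebra_simps)
  then have "(real m * (x a - x b))\<^sup>2 \<le> (\<Sum>i<m. (y i a - y i b)\<^sup>2) * real m"
    using sum_squared_le_sum_of_squares[of "\<lambda>i. y i a - y i b" "{..<m}"] by simp
  then show "real m * (x a - x b)\<^sup>2 \<le> (\<Sum>i<m. (y i a - y i b)\<^sup>2)"
    by (cases "m = 0") (simp_all add: power_mult_distrib power2_eq_square[of "real m"])
qed

lemma translation_convex_sum:
  assumes "\<And>k. k \<in> I \<Longrightarrow> translation_convex n (F k)"
  shows "translation_convex n (\<lambda>x. \<Sum>k\<in>I. F k x)"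
proof (rule translation_convexI)
  fix m :: nat and x :: "nat \<Rightarrow> real" and y :: "nat \<Rightarrow> nat \<Rightarrow> real" and d :: real
  assume y: "\<And>j. j < n \<Longrightarrow> (\<Sum>i<m. y i j) = real m * (x j + d)"
  have "real m * (\<Sum>k\<in>I. F k x) \<le> (\<Sum>k\<in>I. \<Sum>i<m. F k (y i))"
    unfolding sum_distrib_left by (intro sum_mono translation_convexD[OF assms y])
  then show "real m * (\<Sum>k\<in>I. F k x) \<le> (\<Sum>i<m. \<Sum>k\<in>I. F k (y i))"
    by (subst sum.swap)
qed

lemma translation_convex_total_dist: "translation_convex n (total_dist n)"
  unfolding total_dist_def
  by (intro translation_convex_sum translation_convex_square_diff) auto

lemma translation_convex_square_gap:
  assumes "n > 0"
  shows "translation_convex n (\<lambda>x. (gap n x)\<^sup>2)"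
proof (rule translation_convexI)
  fix m :: nat and x :: "nat \<Rightarrow> real" and y :: "nat \<Rightarrow> nat \<Rightarrow> real" and d :: real
  assume y: "\<And>j. j < n \<Longrightarrow> (\<Sum>i<m. y i j) = real m * (x j + d)"
  obtain a b where attained: "a < n" "b < n" "gap n x = x a - x b"
    using gap_attained assms by blast
  have "real m * (x a - x b)\<^sup>2 \<le> (\<Sum>i<m. (y i a - y i b)\<^sup>2)"
    by (rule translation_convexD[OF translation_convex_square_diff[OF attained(1,2)] y])
  also have "\<dots> \<le> (\<Sum>i<m. (gap n (y i))\<^sup>2)"
    by (intro sum_mono square_diff_le_square_gap attained)
  finally show "real m * (gap n x)\<^sup>2 \<le> (\<Sum>i<m. (gap n (y i))\<^sup>2)"
    unfolding attained(3) .
qed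

section \<open>Resampling one edge\<close>

definition upd_fst :: "'i \<Rightarrow> 'a \<Rightarrow> ('i \<Rightarrow> 'a \<times> 'b) \<Rightarrow> 'i \<Rightarrow> 'a \<times> 'b" where
  "upd_fst t a f = f(t := (a, snd (f t)))"

lemma upd_fst_overwrite: "upd_fst t a (f(t := (a', b))) = f(t := (a, b))"
  by (simp add: upd_fst_def)

lemma measurable_upd_fst [measurable (raw)]:
  assumes "t \<in> I" and [measurable]: "g \<in> N \<rightarrow>\<^sub>M A" "f \<in> N \<rightarrow>\<^sub>M (\<Pi>\<^sub>M i\<in>I. A \<Otimes>\<^sub>M B)"
  shows "(\<lambda>z. upd_fst t (g z) (f z)) \<in> N \<rightarrow>\<^sub>M (\<Pi>\<^sub>M i\<in>I. A \<Otimes>\<^sub>M B)"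
  unfolding upd_fst_def using assms(1) by (intro measurable_fun_upd[where J = I]) auto

lemma nn_integral_PiM_remove:
  assumes M: "\<And>i. i \<in> I \<Longrightarrow> prob_space (M i)" and t: "t \<in> I"
    and [measurable]: "f \<in> borel_measurable (PiM I M)"
  shows "(\<integral>\<^sup>+\<omega>. f \<omega> \<partial>PiM I M) = (\<integral>\<^sup>+X. \<integral>\<^sup>+s. f (X(t := s)) \<partial>M t \<partial>PiM (I - {t}) M)"
proof -
  let ?R = "PiM (I - {t}) M"
  have "prob_space (M t)" "prob_space ?R"
    using M t by (auto intro: prob_space_PiM)
  then interpret pair_sigma_finite "M t" ?R
    by (intro pair_sigma_finite.intro prob_space_imp_sigma_finite)
  have insert_remove: "insert t (I - {t}) = I"
    using t by blast
  have [measurable]: "(\<lambda>(s, X). X(t := s)) \<in> M t \<Otimes>\<^sub>M ?R \<rightarrow>\<^sub>M PiM I M"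
    unfolding split_beta using t by (intro measurable_fun_upd[where J = "I - {t}"]) auto
  have "(\<integral>\<^sup>+\<omega>. f \<omega> \<partial>PiM I M) =
      (\<integral>\<^sup>+\<omega>. f \<omega> \<partial>distr (M t \<Otimes>\<^sub>M ?R) (PiM I M) (\<lambda>(s, X). X(t := s)))"
    using distr_pair_PiM_eq_PiM[of "I - {t}" M t] M t unfolding insert_remove by simp
  also have "\<dots> = (\<integral>\<^sup>+z. f ((snd z)(t := fst z)) \<partial>(M t \<Otimes>\<^sub>M ?R))"
    by (subst nn_integral_distr) (auto simp: split_beta)
  also have "\<dots> = (\<integral>\<^sup>+X. \<integral>\<^sup>+s. f (X(t := s)) \<partial>M t \<partial>?R)"
    by (subst nn_integral_snd[symmetric]) auto
  finally show ?thesis .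
qed

lemma distr_PiM_upd_fst:
  assumes A: "prob_space A" and B: "prob_space B" and t: "t \<in> I"
  defines "S \<equiv> \<Pi>\<^sub>M i\<in>I. A \<Otimes>\<^sub>M B"
  shows "distr (A \<Otimes>\<^sub>M S) S (\<lambda>(a, \<omega>). upd_fst t a \<omega>) = S"
proof (rule measure_eqI)
  interpret A: prob_space A by fact
  interpret B: prob_space B by fact
  interpret AB: prob_space "A \<Otimes>\<^sub>M B" by (intro prob_space_pair A B)
  let ?R = "\<Pi>\<^sub>M i\<in>I - {t}. A \<Otimes>\<^sub>M B"
  interpret R: prob_space ?R by (intro prob_space_PiM AB.prob_space_axioms)
  interpret S: prob_space S unfolding S_def by (intro prob_space_PiM AB.prob_space_axioms)
  interpret AR: pair_sigma_finite A ?R ..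
  have [measurable]: "(\<lambda>(s, X). X(t := s)) \<in> (A \<Otimes>\<^sub>M B) \<Otimes>\<^sub>M ?R \<rightarrow>\<^sub>M S"
    unfolding S_def split_beta using t by (intro measurable_fun_upd[where J = "I - {t}"]) auto
  have [measurable]: "(\<lambda>(a, \<omega>). upd_fst t a \<omega>) \<in> A \<Otimes>\<^sub>M S \<rightarrow>\<^sub>M S"
    unfolding S_def using t by measurable
  have nn_integral_S: "(\<integral>\<^sup>+\<omega>. f \<omega> \<partial>S) = (\<integral>\<^sup>+X. \<integral>\<^sup>+a. \<integral>\<^sup>+b. f (X(t := (a, b))) \<partial>B \<partial>A \<partial>?R)"
    if [measurable]: "f \<in> borel_measurable S" for f
  proof -
    have "(\<integral>\<^sup>+\<omega>. f \<omega> \<partial>S) = (\<integral>\<^sup>+X. \<integral>\<^sup>+s. f (X(t := s)) \<partial>(A \<Otimes>\<^sub>M B) \<partial>?R)"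
      using that t unfolding S_def by (intro nn_integral_PiM_remove AB.prob_space_axioms)
    also have "\<dots> = (\<integral>\<^sup>+X. \<integral>\<^sup>+a. \<integral>\<^sup>+b. f (X(t := (a, b))) \<partial>B \<partial>A \<partial>?R)"
      by (intro nn_integral_cong B.nn_integral_fst[symmetric]) measurable
    finally show ?thesis .
  qed
  fix C assume "C \<in> sets (distr (A \<Otimes>\<^sub>M S) S (\<lambda>(a, \<omega>). upd_fst t a \<omega>))"
  then have [measurable]: "C \<in> sets S" by simp
  have "emeasure (distr (A \<Otimes>\<^sub>M S) S (\<lambda>(a, \<omega>). upd_fst t a \<omega>)) C =
      (\<integral>\<^sup>+z. indicator C (upd_fst t (fst z) (snd z)) \<partial>(A \<Otimes>\<^sub>M S))"
    by (subst nn_integral_indicator[symmetric], simp, subst nn_integral_distr) (auto simp: split_beta)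
  also have "\<dots> = (\<integral>\<^sup>+a. \<integral>\<^sup>+\<omega>. indicator C (upd_fst t a \<omega>) \<partial>S \<partial>A)"
    by (subst S.nn_integral_fst[symmetric]) auto
  also have "\<dots> = (\<integral>\<^sup>+a. \<integral>\<^sup>+X. \<integral>\<^sup>+b. indicator C (X(t := (a, b))) \<partial>B \<partial>?R \<partial>A)"
    by (intro nn_integral_cong, subst nn_integral_S) (auto simp: upd_fst_overwrite A.emeasure_space_1)
  also have "\<dots> = (\<integral>\<^sup>+X. \<integral>\<^sup>+a. \<integral>\<^sup>+b. indicator C (X(t := (a, b))) \<partial>B \<partial>A \<partial>?R)"
    by (rule AR.Fubini'[symmetric]) measurable
  also have "\<dots> = emeasure S C"
    by (subst nn_integral_S[symmetric]) auto
  finally show "emeasure (distr (A \<Otimes>\<^sub>M S) S (\<lambda>(a, \<omega>). upd_fst t a \<omega>)) C = emeasure S C" .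
qed simp

section \<open>Trajectories\<close>

lemma loads_cong:
  assumes "\<And>s. s < t \<Longrightarrow> \<omega> s = \<omega>' s"
  shows "loads n x0 \<omega> t = loads n x0 \<omega>' t"
  using assms by (induction t) auto

lemma loads_upd_fst:
  "loads n x0 (upd_fst t i \<omega>) (Suc t) = average_step n (i, snd (\<omega> t)) (loads n x0 \<omega> t)"
  using loads_cong[of t "upd_fst t i \<omega>" \<omega>] by (simp add: upd_fst_def)

lemma abs_loads_diff_le: "\<bar>loads n x0 \<omega> t j - x0\<bar> \<le> (\<Sum>s<t. \<bar>snd (\<omega> s)\<bar>)"
proof (induction t arbitrary: j)
  case 0
  then show ?case by simp
next
  case (Suc t)
  obtain i w where "\<omega> t = (i, w)" by (cases "\<omega> t")
  then show ?case
    using Suc[of j] Suc[of i] Suc[of "Suc i mod n"]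
    by (auto simp: average_step_apply abs_le_iff field_simps)
qed

lemma square_gap_loads_le:
  assumes "n > 0"
  shows "(gap n (loads n x0 \<omega> t))\<^sup>2 \<le> 4 * real t * (\<Sum>s<t. (snd (\<omega> s))\<^sup>2)"
proof -
  let ?x = "loads n x0 \<omega> t" and ?B = "\<Sum>s<t. \<bar>snd (\<omega> s)\<bar>"
  obtain a b where attained: "gap n ?x = ?x a - ?x b"
    using gap_attained assms by metis
  have "\<bar>gap n ?x\<bar> \<le> 2 * ?B"
    unfolding attained
    using abs_loads_diff_le[of n x0 \<omega> t a] abs_loads_diff_le[of n x0 \<omega> t b] by linarith
  then have "(gap n ?x)\<^sup>2 \<le> (2 * ?B)\<^sup>2"
    by (metis abs_ge_zero power2_abs power_mono)
  also have "\<dots> \<le> 4 * real t * (\<Sum>s<t. (snd (\<omega> s))\<^sup>2)"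
    using sum_squared_le_sum_of_squares[of "\<lambda>s. \<bar>snd (\<omega> s)\<bar>" "{..<t}"]
    by (simp add: power_mult_distrib mult_ac)
  finally show ?thesis .
qed

lemma sum_edges_average_step_const:
  assumes "n \<ge> 2" "j < n"
  shows "(\<Sum>i<n. average_step n (i, w) (\<lambda>_. c) j) = real n * c + w"
proof -
  have "average_step n (i, w) (\<lambda>_. c) j =
      c + (if i = j then w / 2 else 0) + (if Suc i mod n = j then w / 2 else 0)" if "i < n" for i
    using Suc_mod_neq[OF that assms(1)] by (auto simp: average_step_apply field_simps)
  then have "(\<Sum>i<n. average_step n (i, w) (\<lambda>_. c) j) =
      real n * c + (\<Sum>i<n. if i = j then w / 2 else 0) + (\<Sum>i<n. if Suc i mod n = j then w / 2 else 0)"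
    by (simp add: sum.distrib)
  then show ?thesis
    using assms sum_mod_Suc[of n "\<lambda>i. if i = j then w / 2 else 0"] by simp
qed

lemma sum_average_step_affine:
  assumes "i < n" "j < n" "\<And>j. j < n \<Longrightarrow> (\<Sum>l<m. y l j) = real m * (x j + d)"
  shows "(\<Sum>l<m. average_step n (i, w) (y l) j) = real m * (average_step n (i, w) x j + d)"
proof -
  have "(\<Sum>l<m. y l i) = real m * (x i + d)" "(\<Sum>l<m. y l j) = real m * (x j + d)"
    "(\<Sum>l<m. y l (Suc i mod n)) = real m * (x (Suc i mod n) + d)"
    using assms by auto
  then show ?thesis
    by (simp add: average_step_apply sum.distrib sum_divide_distrib[symmetric] field_simps)
qed

lemma sum_loads_upd_fst_0:
  assumes "n \<ge> 2" "\<And>s. fst (\<omega> s) < n" "j < n"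
  shows "(\<Sum>i<n. loads n x0 (upd_fst 0 i \<omega>) (Suc t) j) =
    real n * (loads n x0 (\<omega> \<circ> Suc) t j + snd (\<omega> 0) / real n)"
  using assms(3)
proof (induction t arbitrary: j)
  case 0
  then show ?case
    unfolding loads_upd_fst using assms(1) by (simp add: sum_edges_average_step_const field_simps)
next
  case (Suc t)
  obtain e w where step: "\<omega> (Suc t) = (e, w)" by (cases "\<omega> (Suc t)")
  then have e_less: "e < n" using assms(2)[of "Suc t"] by simp
  have "(\<Sum>i<n. loads n x0 (upd_fst 0 i \<omega>) (Suc (Suc t)) j) =
      (\<Sum>i<n. average_step n (e, w) (loads n x0 (upd_fst 0 i \<omega>) (Suc t)) j)"
    by (simp add: step upd_fst_def)
  also have "\<dots> = real n * (average_step n (e, w) (loads n x0 (\<omega> \<circ> Suc) t) j + snd (\<omega> 0) / real n)"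
    by (rule sum_average_step_affine[OF e_less Suc.prems Suc.IH])
  finally show ?case
    by (simp add: step comp_def)
qed

section \<open>The process\<close>

locale cycle_process = W: real_distribution W for W :: "real measure" +
  fixes n :: nat
  assumes n_pos: "n > 0"
begin

abbreviation "P \<equiv> process_space n W"
abbreviation "edges \<equiv> measure_pmf (pmf_of_set {..<n})"

lemma prob_space_step: "prob_space (edges \<Otimes>\<^sub>M W)"
  by (intro prob_space_pair measure_pmf.prob_space_axioms W.prob_space_axioms)

sublocale process: prob_space P
  unfolding process_space_def by (intro prob_space_PiM prob_space_step)

lemma set_pmf_edges: "set_pmf (pmf_of_set {..<n}) = {..<n}"
  using n_pos by (intro set_pmf_of_set) (auto simp: lessThan_empty_iff)

lemma distr_resample_edge:
  "distr (edges \<Otimes>\<^sub>M P) P (\<lambda>(i, \<omega>). upd_fst t i \<omega>) = P"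
  unfolding process_space_def
  by (rule distr_PiM_upd_fst[OF measure_pmf.prob_space_axioms W.prob_space_axioms UNIV_I])

lemma
  fixes f :: "(nat \<Rightarrow> nat \<times> real) \<Rightarrow> real"
  assumes f: "integrable P f"
  shows integrable_resample_edge:
      "i < n \<Longrightarrow> integrable P (\<lambda>\<omega>. f (upd_fst t i \<omega>))"
    and integral_resample_edge:
      "(\<integral>\<omega>. f \<omega> \<partial>P) = (\<Sum>i<n. \<integral>\<omega>. f (upd_fst t i \<omega>) \<partial>P) / real n"
proof -
  interpret pair_sigma_finite edges P ..
  let ?g = "\<lambda>(i, \<omega>). upd_fst t i \<omega>"
  have [measurable]: "?g \<in> edges \<Otimes>\<^sub>M P \<rightarrow>\<^sub>M P"
    unfolding process_space_def by measurable
  have integrable_pair: "integrable (edges \<Otimes>\<^sub>M P) (\<lambda>z. f (?g z))"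
    using f by (intro integrable_distr[of ?g _ P]) (simp_all add: distr_resample_edge)
  show "i < n \<Longrightarrow> integrable P (\<lambda>\<omega>. f (upd_fst t i \<omega>))"
    using AE_integrable_fst'[OF integrable_pair] by (simp add: AE_measure_pmf_iff set_pmf_edges)
  have "(\<integral>\<omega>. f \<omega> \<partial>P) = (\<integral>z. f (?g z) \<partial>(edges \<Otimes>\<^sub>M P))"
    using f by (subst distr_resample_edge[of t, symmetric]) (simp add: integral_distr)
  also have "\<dots> = (\<integral>i. \<integral>\<omega>. f (upd_fst t i \<omega>) \<partial>P \<partial>edges)"
    by (subst integral_fst'[OF integrable_pair, symmetric]) simp
  also have "\<dots> = (\<Sum>i<n. \<integral>\<omega>. f (upd_fst t i \<omega>) \<partial>P) / real n"
    using n_pos by (subst integral_pmf_of_set) (auto simp: lessThan_empty_iff)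
  finally show "(\<integral>\<omega>. f \<omega> \<partial>P) = (\<Sum>i<n. \<integral>\<omega>. f (upd_fst t i \<omega>) \<partial>P) / real n" .
qed

lemma distr_shift: "distr P P (\<lambda>\<omega>. \<omega> \<circ> Suc) = P"
  using distr_PiM_reindex[of UNIV "\<lambda>_. edges \<Otimes>\<^sub>M W" Suc UNIV] prob_space_step
  by (simp add: process_space_def comp_def restrict_UNIV)

lemma measurable_shift: "(\<lambda>\<omega>. \<omega> \<circ> Suc) \<in> P \<rightarrow>\<^sub>M P"
  unfolding process_space_def comp_def by (rule measurable_PiM_single') (auto simp: space_PiM)

lemma
  fixes f :: "(nat \<Rightarrow> nat \<times> real) \<Rightarrow> real"
  assumes "integrable P f"
  shows integrable_shift: "integrable P (\<lambda>\<omega>. f (\<omega> \<circ> Suc))"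
    and integral_shift: "(\<integral>\<omega>. f (\<omega> \<circ> Suc) \<partial>P) = (\<integral>\<omega>. f \<omega> \<partial>P)"
  using assms integrable_distr[OF measurable_shift, of f] integral_distr[OF measurable_shift, of f]
  by (simp_all add: distr_shift)

lemma distr_component: "distr P (edges \<Otimes>\<^sub>M W) (\<lambda>\<omega>. \<omega> t) = edges \<Otimes>\<^sub>M W"
  unfolding process_space_def by (intro distr_PiM_component prob_space_step) simp

lemma measurable_step [measurable]: "(\<lambda>\<omega>. \<omega> t) \<in> P \<rightarrow>\<^sub>M edges \<Otimes>\<^sub>M W"
  unfolding process_space_def by measurable

lemma distr_weight: "distr P W (\<lambda>\<omega>. snd (\<omega> t)) = W"
proof -
  interpret pair_sigma_finite edges W ..
  have "distr P W (\<lambda>\<omega>. snd (\<omega> t)) = distr (distr P (edges \<Otimes>\<^sub>M W) (\<lambda>\<omega>. \<omega> t)) W snd"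
    by (subst distr_distr) (auto simp: comp_def)
  also have "\<dots> = distr (W \<Otimes>\<^sub>M edges) W fst"
    unfolding distr_component by (subst distr_pair_swap) (simp add: distr_distr comp_def split_beta)
  finally show ?thesis
    by (simp add: measure_pmf.distr_pair_fst)
qed

lemma AE_edge_less: "AE \<omega> in P. \<forall>t. fst (\<omega> t) < n"
proof -
  have "AE i in distr (edges \<Otimes>\<^sub>M W) edges fst. i < n"
    unfolding W.distr_pair_fst by (simp add: AE_measure_pmf_iff set_pmf_edges)
  then have "AE s in edges \<Otimes>\<^sub>M W. fst s < n"
    by (rule AE_distrD[OF measurable_fst])
  then show ?thesis
    unfolding AE_all_countable process_space_def
    by (intro allI AE_PiM_component prob_space_step) auto
qed

lemma measurable_loads [measurable]: "(\<lambda>\<omega>. loads n x0 \<omega> t j) \<in> borel_measurable P"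
proof (induction t arbitrary: j)
  case 0
  then show ?case by simp
next
  case (Suc t)
  note Suc [measurable]
  have [measurable]: "(\<lambda>\<omega>. snd (\<omega> t)) \<in> borel_measurable P"
    by (rule measurable_compose[OF measurable_step]) simp
  have edge: "(\<lambda>\<omega>. fst (\<omega> t)) \<in> P \<rightarrow>\<^sub>M count_space UNIV"
    by (rule measurable_compose[OF measurable_step measurable_fst, unfolded measurable_pmf_measure2])
  have "(\<lambda>\<omega>. average_step n (i, snd (\<omega> t)) (loads n x0 \<omega> t) j) \<in> borel_measurable P" for i
    unfolding average_step_apply by measurable
  then have "(\<lambda>\<omega>. average_step n (fst (\<omega> t), snd (\<omega> t)) (loads n x0 \<omega> t) j) \<in> borel_measurable P"
    by (rule measurable_compose_countable[OF _ edge])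
  then show ?case by simp
qed

lemma measurable_shift_dist_loads [measurable]:
  "(\<lambda>\<omega>. shift_dist n k (loads n x0 \<omega> t)) \<in> borel_measurable P"
  unfolding shift_dist_def by measurable

lemma measurable_total_dist_loads [measurable]:
  "(\<lambda>\<omega>. total_dist n (loads n x0 \<omega> t)) \<in> borel_measurable P"
  unfolding total_dist_def by measurable

lemma measurable_gap_loads [measurable]:
  "(\<lambda>\<omega>. gap n (loads n x0 \<omega> t)) \<in> borel_measurable P"
  unfolding gap_def by measurable

lemma integral_loads_Suc:
  fixes F :: "(nat \<Rightarrow> real) \<Rightarrow> real"
  assumes "integrable P (\<lambda>\<omega>. F (loads n x0 \<omega> (Suc t)))"
  shows "real n * (\<integral>\<omega>. F (loads n x0 \<omega> (Suc t)) \<partial>P) =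
    (\<integral>\<omega>. (\<Sum>i<n. F (average_step n (i, snd (\<omega> t)) (loads n x0 \<omega> t))) \<partial>P)"
  using integral_resample_edge[OF assms, of t] integrable_resample_edge[OF assms, of _ t] n_pos
  unfolding loads_upd_fst by simp

lemma incseq_integral_translation_convex:
  fixes F :: "(nat \<Rightarrow> real) \<Rightarrow> real"
  assumes n: "n \<ge> 2" and F: "translation_convex n F"
    and integrable: "\<And>t. integrable P (\<lambda>\<omega>. F (loads n x0 \<omega> t))"
  shows "incseq (\<lambda>t. \<integral>\<omega>. F (loads n x0 \<omega> t) \<partial>P)"
proof (rule incseq_SucI)
  fix t
  have "AE \<omega> in P. real n * F (loads n x0 (\<omega> \<circ> Suc) t) \<le>
      (\<Sum>i<n. F (loads n x0 (upd_fst 0 i \<omega>) (Suc t)))"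
    using AE_edge_less
  proof eventually_elim
    case (elim \<omega>)
    then show ?case
      by (intro translation_convexD[OF F, where d = "snd (\<omega> 0) / real n"]
          sum_loads_upd_fst_0[OF n]) auto
  qed
  then have "(\<integral>\<omega>. real n * F (loads n x0 (\<omega> \<circ> Suc) t) \<partial>P) \<le>
      (\<integral>\<omega>. (\<Sum>i<n. F (loads n x0 (upd_fst 0 i \<omega>) (Suc t))) \<partial>P)"
    by (intro integral_mono_AE integrable_mult_right Bochner_Integration.integrable_sum
        integrable_shift[OF integrable] integrable_resample_edge[OF integrable]) auto
  also have "\<dots> = real n * (\<integral>\<omega>. F (loads n x0 \<omega> (Suc t)) \<partial>P)"
    using integral_resample_edge[OF integrable, of "Suc t" 0]
      integrable_resample_edge[OF integrable, of _ 0 "Suc t"] n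
    by (simp del: loads.simps)
  finally have "real n * (\<integral>\<omega>. F (loads n x0 \<omega> t) \<partial>P) \<le>
      real n * (\<integral>\<omega>. F (loads n x0 \<omega> (Suc t)) \<partial>P)"
    using integral_shift[OF integrable, of t] by simp
  then show "(\<integral>\<omega>. F (loads n x0 \<omega> t) \<partial>P) \<le> (\<integral>\<omega>. F (loads n x0 \<omega> (Suc t)) \<partial>P)"
    using n by simp
qed

end

section \<open>Finite second moment\<close>

lemma square_le_mult_div_2:
  assumes "n \<ge> 3"
  shows "(real n)\<^sup>2 / 9 \<le> real (n div 2) * (real n - real (n div 2)) - 1"
proof -
  have "real n = 2 * real (n div 2) \<or> real n = 2 * real (n div 2) + 1"
    by (cases "even n") (auto elim!: evenE oddE)
  then have "real (n div 2) * (real n - real (n div 2)) \<ge> ((real n)\<^sup>2 - 1) / 4"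
    by (elim disjE) (simp_all add: power2_eq_square field_simps)
  moreover have "(real n)\<^sup>2 \<ge> 3\<^sup>2"
    using assms by (intro power_mono) auto
  ultimately show ?thesis by simp
qed

locale cycle_process_L2 = cycle_process +
  fixes x0 :: real
  assumes n_ge_3: "n \<ge> 3"
    and square_integrable: "integrable W (\<lambda>w. w\<^sup>2)"
begin

abbreviation "second_moment \<equiv> \<integral>w. w\<^sup>2 \<partial>W"

lemma integrable_weight_square: "integrable P (\<lambda>\<omega>. (snd (\<omega> t))\<^sup>2)"
  using square_integrable
  by (intro integrable_distr[of "\<lambda>\<omega>. snd (\<omega> t)" P W "\<lambda>w. w\<^sup>2"]) (auto simp: distr_weight)

lemma integral_weight_square: "(\<integral>\<omega>. (snd (\<omega> t))\<^sup>2 \<partial>P) = second_moment"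
proof -
  have "second_moment = (\<integral>w. w\<^sup>2 \<partial>distr P W (\<lambda>\<omega>. snd (\<omega> t)))"
    unfolding distr_weight ..
  also have "\<dots> = (\<integral>\<omega>. (snd (\<omega> t))\<^sup>2 \<partial>P)"
    by (rule integral_distr) auto
  finally show ?thesis by simp
qed

lemma integrable_square_gap: "integrable P (\<lambda>\<omega>. (gap n (loads n x0 \<omega> t))\<^sup>2)"
proof (rule Bochner_Integration.integrable_bound)
  show "integrable P (\<lambda>\<omega>. 4 * real t * (\<Sum>s<t. (snd (\<omega> s))\<^sup>2))"
    by (intro integrable_mult_right Bochner_Integration.integrable_sum integrable_weight_square)
  show "AE \<omega> in P. norm ((gap n (loads n x0 \<omega> t))\<^sup>2) \<le> norm (4 * real t * (\<Sum>s<t. (snd (\<omega> s))\<^sup>2))"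
    using square_gap_loads_le[OF n_pos] by (auto simp: abs_of_nonneg sum_nonneg)
qed measurable

lemma integrable_if_le_square_gap:
  fixes F :: "(nat \<Rightarrow> real) \<Rightarrow> real"
  assumes "(\<lambda>\<omega>. F (loads n x0 \<omega> t)) \<in> borel_measurable P"
    and "\<And>x. 0 \<le> F x" "\<And>x. F x \<le> c * (gap n x)\<^sup>2"
  shows "integrable P (\<lambda>\<omega>. F (loads n x0 \<omega> t))"
proof (rule Bochner_Integration.integrable_bound)
  show "integrable P (\<lambda>\<omega>. c * (gap n (loads n x0 \<omega> t))\<^sup>2)"
    by (intro integrable_mult_right integrable_square_gap)
  show "AE \<omega> in P. norm (F (loads n x0 \<omega> t)) \<le> norm (c * (gap n (loads n x0 \<omega> t))\<^sup>2)"
    using assms(2,3) by (intro AE_I2) (metis order_trans real_norm_def abs_of_nonneg)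
qed fact

lemma integrable_shift_dist: "integrable P (\<lambda>\<omega>. shift_dist n k (loads n x0 \<omega> t))"
  by (rule integrable_if_le_square_gap[OF _ shift_dist_nonneg shift_dist_le_square_gap]) measurable

lemma integrable_total_dist: "integrable P (\<lambda>\<omega>. total_dist n (loads n x0 \<omega> t))"
  by (rule integrable_if_le_square_gap[OF _ total_dist_nonneg total_dist_le_square_gap]) measurable

definition mean_square_gap :: "nat \<Rightarrow> real" where
  "mean_square_gap t = (\<integral>\<omega>. (gap n (loads n x0 \<omega> t))\<^sup>2 \<partial>P)"

definition mean_shift_dist :: "nat \<Rightarrow> nat \<Rightarrow> real" where
  "mean_shift_dist k t = (\<integral>\<omega>. shift_dist n k (loads n x0 \<omega> t) \<partial>P)"

definition mean_total_dist :: "nat \<Rightarrow> real" where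
  "mean_total_dist t = (\<integral>\<omega>. total_dist n (loads n x0 \<omega> t) \<partial>P)"

lemma incseq_mean_square_gap: "incseq mean_square_gap"
  unfolding mean_square_gap_def using n_ge_3
  by (intro incseq_integral_translation_convex translation_convex_square_gap integrable_square_gap) auto

lemma incseq_mean_total_dist: "incseq mean_total_dist"
  unfolding mean_total_dist_def using n_ge_3
  by (intro incseq_integral_translation_convex translation_convex_total_dist integrable_total_dist) auto

lemma mean_shift_dist_le_mean_square_gap: "mean_shift_dist k t \<le> real n * mean_square_gap t"
  unfolding mean_shift_dist_def mean_square_gap_def integral_mult_right_zero[symmetric]
  by (intro integral_mono integrable_shift_dist integrable_mult_right integrable_square_gap
      shift_dist_le_square_gap)

lemma mean_total_dist_le_mean_square_gap: "mean_total_dist t \<le> (real n)\<^sup>2 * mean_square_gap t"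
  unfolding mean_total_dist_def mean_square_gap_def integral_mult_right_zero[symmetric]
  by (intro integral_mono integrable_total_dist integrable_mult_right integrable_square_gap
      total_dist_le_square_gap)

lemma mean_square_gap_le_mean_shift_dist: "mean_square_gap t \<le> real n * mean_shift_dist 1 t"
  unfolding mean_shift_dist_def mean_square_gap_def integral_mult_right_zero[symmetric]
  by (intro integral_mono integrable_shift_dist integrable_mult_right integrable_square_gap
      square_gap_le_shift_dist n_pos)

lemma mean_total_dist_Suc:
  "mean_total_dist (Suc t) = mean_total_dist t - mean_shift_dist 1 t + (real n - 2) * second_moment"
proof -
  have "real n * mean_total_dist (Suc t) =
      (\<integral>\<omega>. real n * (total_dist n (loads n x0 \<omega> t) - shift_dist n 1 (loads n x0 \<omega> t)
        + (real n - 2) * (snd (\<omega> t))\<^sup>2) \<partial>P)"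
    unfolding mean_total_dist_def integral_loads_Suc[OF integrable_total_dist]
    using n_ge_3 by (simp add: sum_edges_total_dist_average_step)
  also have "\<dots> = real n * (mean_total_dist t - mean_shift_dist 1 t + (real n - 2) * second_moment)"
    by (simp add: mean_total_dist_def mean_shift_dist_def integral_weight_square integrable_weight_square
        integrable_total_dist integrable_shift_dist)
  finally show ?thesis
    using n_pos by simp
qed

lemma mean_shift_dist_Suc:
  assumes "1 \<le> k" "k + 2 \<le> n"
  shows "real n * mean_shift_dist k (Suc t) =
    (real n - 2) * mean_shift_dist k t + mean_shift_dist (k - 1) t + mean_shift_dist (k + 1) t
    + (if k = 1 then 1 / 2 else 1) * (real n * second_moment - mean_shift_dist 1 t)"
  unfolding mean_shift_dist_def integral_loads_Suc[OF integrable_shift_dist]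
    sum_edges_shift_dist_average_step[OF assms]
  by (simp add: integral_weight_square integrable_weight_square integrable_shift_dist)

lemma mean_shift_dist_1_le: "mean_shift_dist 1 t \<le> (real n - 2) * second_moment"
  using incseq_SucD[OF incseq_mean_total_dist, of t] mean_total_dist_Suc[of t] by simp

lemma mean_square_gap_le: "mean_square_gap t \<le> real n * ((real n - 2) * second_moment)"
  using mean_square_gap_le_mean_shift_dist[of t]
    mult_left_mono[OF mean_shift_dist_1_le[of t], of "real n"] by simp

lemma convergent_mean_square_gap: "convergent mean_square_gap"
  using incseq_convergent[OF incseq_mean_square_gap] mean_square_gap_le by (metis convergent_def)

lemma convergent_mean_total_dist: "convergent mean_total_dist"
proof -
  have "mean_total_dist t \<le> (real n)\<^sup>2 * (real n * ((real n - 2) * second_moment))" for t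
    using mean_total_dist_le_mean_square_gap[of t]
      mult_left_mono[OF mean_square_gap_le[of t], of "(real n)\<^sup>2"] by simp
  then show ?thesis
    using incseq_convergent[OF incseq_mean_total_dist] by (metis convergent_def)
qed

lemma mean_shift_dist_1_limit: "mean_shift_dist 1 \<longlonglongrightarrow> (real n - 2) * second_moment"
proof -
  obtain L where "mean_total_dist \<longlonglongrightarrow> L"
    using convergent_mean_total_dist by (auto simp: convergent_def)
  then have "(\<lambda>t. mean_total_dist t - mean_total_dist (Suc t) + (real n - 2) * second_moment)
      \<longlonglongrightarrow> L - L + (real n - 2) * second_moment"
    by (intro tendsto_intros LIMSEQ_Suc)
  then show ?thesis
    by (simp add: mean_total_dist_Suc)
qed

lemma mean_shift_dist_Suc_limit:
  assumes k: "1 \<le> k" "k + 2 \<le> n"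
    and prev: "mean_shift_dist (k - 1) \<longlonglongrightarrow> p" and curr: "mean_shift_dist k \<longlonglongrightarrow> q"
  shows "mean_shift_dist (k + 1) \<longlonglongrightarrow> 2 * q - p - (if k = 1 then 1 else 2) * second_moment"
proof -
  let ?c = "if k = 1 then 1 / 2 else 1 :: real"
  have "mean_shift_dist (k + 1) = (\<lambda>t. real n * mean_shift_dist k (Suc t)
      - (real n - 2) * mean_shift_dist k t - mean_shift_dist (k - 1) t
      - ?c * (real n * second_moment - mean_shift_dist 1 t))"
    unfolding mean_shift_dist_Suc[OF k] by simp
  also have "\<dots> \<longlonglongrightarrow> real n * q - (real n - 2) * q - p
      - ?c * (real n * second_moment - (real n - 2) * second_moment)"
    by (intro tendsto_intros LIMSEQ_Suc prev curr mean_shift_dist_1_limit)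
  also have "real n * q - (real n - 2) * q - p
      - ?c * (real n * second_moment - (real n - 2) * second_moment)
      = 2 * q - p - (if k = 1 then 1 else 2) * second_moment"
    by (simp add: algebra_simps)
  finally show ?thesis .
qed

lemma mean_shift_dist_limit:
  assumes "1 \<le> k" "k < n"
  shows "mean_shift_dist k \<longlonglongrightarrow> second_moment * (real k * (real n - real k) - 1)"
  using assms
proof (induction k rule: less_induct)
  case (less k)
  consider "k = 1" | "k = 2" | l where "k = l + 1" "2 \<le> l"
    using less.prems that(3)[of "k - 1"] by fastforce
  then show ?case
  proof cases
    case 1
    then show ?thesis
      using mean_shift_dist_1_limit by (simp add: algebra_simps)
  next
    case 2
    have "mean_shift_dist 0 = (\<lambda>_. 0)"
      by (simp add: fun_eq_iff mean_shift_dist_def)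
    then have "mean_shift_dist (1 + 1) \<longlonglongrightarrow> 2 * ((real n - 2) * second_moment) - 0 - 1 * second_moment"
      using mean_shift_dist_Suc_limit[of 1 0, OF _ _ _ mean_shift_dist_1_limit] n_ge_3 by simp
    then show ?thesis
      by (simp add: 2 numeral_2_eq_2 algebra_simps)
  next
    case (3 l)
    have "mean_shift_dist (l + 1) \<longlonglongrightarrow>
        2 * (second_moment * (real l * (real n - real l) - 1))
        - second_moment * (real (l - 1) * (real n - real (l - 1)) - 1) - 2 * second_moment"
      using mean_shift_dist_Suc_limit[OF _ _ less.IH less.IH, of l] 3 less.prems by simp
    also have "2 * (second_moment * (real l * (real n - real l) - 1))
        - second_moment * (real (l - 1) * (real n - real (l - 1)) - 1) - 2 * second_moment
      = second_moment * (real k * (real n - real k) - 1)"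
      using 3 by (simp add: of_nat_diff algebra_simps)
    finally show ?thesis
      using 3 by simp
  qed
qed

lemma mean_square_gap_limit_ge:
  assumes "mean_square_gap \<longlonglongrightarrow> L"
  shows "1 / 9 * real n * second_moment \<le> L"
proof -
  let ?m = "n div 2"
  have "real n * (1 / 9 * real n * second_moment) = second_moment * ((real n)\<^sup>2 / 9)"
    by (simp add: power2_eq_square)
  also have "\<dots> \<le> second_moment * (real ?m * (real n - real ?m) - 1)"
    using n_ge_3 by (intro mult_left_mono square_le_mult_div_2) auto
  also have "\<dots> \<le> real n * L"
  proof (rule LIMSEQ_le)
    show "mean_shift_dist ?m \<longlonglongrightarrow> second_moment * (real ?m * (real n - real ?m) - 1)"
      using n_ge_3 by (intro mean_shift_dist_limit) auto
    show "(\<lambda>t. real n * mean_square_gap t) \<longlonglongrightarrow> real n * L"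
      by (intro tendsto_intros assms)
  qed (use mean_shift_dist_le_mean_square_gap in blast)
  finally show ?thesis
    using n_pos by simp
qed

end

theorem theorem2:
  "\<exists>c::real. c > 0 \<and>
     (\<forall>(n::nat) (W::real measure) (x0::real).
        n \<ge> 3 \<longrightarrow> real_distribution W \<longrightarrow> integrable W (\<lambda>w. w\<^sup>2) \<longrightarrow>
        (\<exists>L::real.
           (\<lambda>t. \<integral>\<omega>. (gap n (loads n x0 \<omega> t))\<^sup>2 \<partial>process_space n W) \<longlonglongrightarrow> L \<and>
           L \<ge> c * real n * (\<integral>w. w\<^sup>2 \<partial>W)))"
proof (rule exI[of _ "1 / 9"], intro conjI allI impI)
  fix n :: nat and W :: "real measure" and x0 :: real
  assume n: "n \<ge> 3" and W: "real_distribution W" "integrable W (\<lambda>w. w\<^sup>2)"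
  interpret W: real_distribution W by fact
  interpret cycle_process_L2 W n x0
    using n W by unfold_locales auto
  obtain L where "mean_square_gap \<longlonglongrightarrow> L"
    using convergent_mean_square_gap by (auto simp: convergent_def)
  with mean_square_gap_limit_ge
  show "\<exists>L. (\<lambda>t. \<integral>\<omega>. (gap n (loads n x0 \<omega> t))\<^sup>2 \<partial>process_space n W) \<longlonglongrightarrow> L \<and>
      L \<ge> 1 / 9 * real n * (\<integral>w. w\<^sup>2 \<partial>W)"
    unfolding mean_square_gap_def by blast
qed simp

end
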